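(* Let $H_0=1$, $H_1=7$, and for $n\ge2$ let $$H_n=5H_{n-1}+5H_{n-2}.$$ Then for all $n\ge 1$ the number of product-centered local triangles is $$|P_n\cap L_n|=\frac{H_n-4^n}{3}.$$ The first values (for $n=1,\dots,6$) are $1,8,57,373,2342,14343$.
   Context: $\Delta_n=\{i,j,k,e\}^n$ is the set of words $b=b_1b_2\cdots b_n$ of length $n$ in the four symbols $i,j,k,e$. Put $v(i)=(\cos 210^\circ,\sin 210^\circ)$, $v(j)=(\cos 90^\circ,\sin 90^\circ)$, $v(k)=(\cos 330^\circ,\sin 330^\circ)$, $v(e)=(0,0)$ in $\mathbb R^2$. Fix a real $d_1>0$ and put $d_r=d_1/2^{r-1}$. The centroid map $P:\Delta_n\to\mathbb R^2$ is $$P(b)=\sum_{r=1}^n \sigma_r(b)\,d_r\,v(b_r),\qquad \sigma_r(b)=(-1)^{\#\{s<r:\ b_s=e\}}.$$ $E_n$ is the set of unordered triples $\{b_1,b_2,b_3\}$ of distinct words in $\Delta_n$ such that $P(b_1),P(b_2),P(b_3)$ are the vertices of a nondegenerate equilateral triangle. For $b\in\Delta_n$ put $\mathrm{supp}(b)=\{r: b_r\ne e\}$. Let $\gamma$ be the permutation $i\mapsto j\mapsto k\mapsto i$, $e\mapsto e$. For nonempty $S\subseteq\mathrm{supp}(b)$, $\gamma_S(b)$ is obtained by applying $\gamma$ in the coordinates of $S$ and fixing the others, and $T(b,S)=\{b,\gamma_S(b),\gamma_S^2(b)\}$, which is always an element of $E_n$. The local class is $L_n=\{T(b,S): b\in\Delta_n,\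 \varnothing\ne S\subseteq\mathrm{supp}(b)\}\subseteq E_n$. Words are multiplied coordinatewise as quaternions ($e$ the identity, $i^2=j^2=k^2=-e$, $ij=k$, $jk=i$, $ki=j$, distinct elements of $\{i,j,k\}$ anticommute), with local signs collected into one global sign, giving an element of $\{\pm b:b\in\Delta_n\}$; let $u(\pm b)=b$ for $b\in\Delta_n$. Any two words commute or anticommute, so for $T=\{b_1,b_2,b_3\}\in E_n$ the word $p(T)=u(b_1b_2b_3)$ is well defined. Put $C_T=P(p(T))$ (the product point) and $Q_T=\frac13(P(b_1)+P(b_2)+P(b_3))$. $T$ is product-centered if $C_T=Q_T$, and $P_n=\{T\in E_n: C_T=Q_T\}$. *)

theory Defs
  imports "HOL-Analysis.Analysis"
begin

datatype letter = Qi | Qj | Qk | Qe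

text \<open>
  Words are lists of letters, so coordinates are numbered \<open>0, \<dots>, n - 1\<close> rather than
  \<open>1, \<dots>, n\<close>.
\<close>
type_synonym word = "letter list"

definition Delta :: "nat \<Rightarrow> word set" where
  "Delta n = {b. length b = n}"

fun vdir :: "letter \<Rightarrow> real \<times> real" where
  "vdir Qi = (cos (210 * pi / 180), sin (210 * pi / 180))"
| "vdir Qj = (cos (90 * pi / 180), sin (90 * pi / 180))"
| "vdir Qk = (cos (330 * pi / 180), sin (330 * pi / 180))"
| "vdir Qe = (0, 0)"

definition sgn_at :: "word \<Rightarrow> nat \<Rightarrow> real" where
  "sgn_at b r = (- 1) ^ card {s. s < r \<and> b ! s = Qe}"

text \<open>
  The argument \<open>d\<close> is the leading scale \<open>d\<^sub>1\<close>. With coordinates numbered from \<open>0\<close>, the scale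
  \<open>d\<^sub>r = d\<^sub>1 / 2\<^bsup>r-1\<^esup>\<close> becomes \<open>d / 2 ^ r\<close>.
\<close>
definition centroid :: "real \<Rightarrow> word \<Rightarrow> real \<times> real" where
  "centroid d b = (\<Sum>r<length b. (sgn_at b r * (d / 2 ^ r)) *\<^sub>R vdir (b ! r))"

definition equilateral :: "real \<times> real \<Rightarrow> real \<times> real \<Rightarrow> real \<times> real \<Rightarrow> bool" where
  "equilateral x y z \<longleftrightarrow> dist x y = dist y z \<and> dist y z = dist z x \<and> dist x y > 0"

definition triangles :: "real \<Rightarrow> nat \<Rightarrow> word set set" where
  "triangles d n = {{b1, b2, b3} | b1 b2 b3.
     b1 \<in> Delta n \<and> b2 \<in> Delta n \<and> b3 \<in> Delta n \<and> b1 \<noteq> b2 \<and> b2 \<noteq> b3 \<and> b1 \<noteq> b3 \<and>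
     equilateral (centroid d b1) (centroid d b2) (centroid d b3)}"

definition supp :: "word \<Rightarrow> nat set" where
  "supp b = {r. r < length b \<and> b ! r \<noteq> Qe}"

fun gam :: "letter \<Rightarrow> letter" where
  "gam Qi = Qj"
| "gam Qj = Qk"
| "gam Qk = Qi"
| "gam Qe = Qe"

definition gamS :: "nat set \<Rightarrow> word \<Rightarrow> word" where
  "gamS S b = map (\<lambda>r. if r \<in> S then gam (b ! r) else b ! r) [0..<length b]"

definition loc_tri :: "word \<Rightarrow> nat set \<Rightarrow> word set" where
  "loc_tri b S = {b, gamS S b, gamS S (gamS S b)}"

definition local_class :: "nat \<Rightarrow> word set set" where
  "local_class n = {loc_tri b S | b S. b \<in> Delta n \<and> S \<noteq> {} \<and> S \<subseteq> supp b}"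

text \<open>Quaternion multiplication of two letters: a sign in \<open>{1, -1}\<close> and a letter.\<close>
fun lmult :: "letter \<Rightarrow> letter \<Rightarrow> int \<times> letter" where
  "lmult Qe x = (1, x)"
| "lmult x Qe = (1, x)"
| "lmult Qi Qi = (- 1, Qe)"
| "lmult Qj Qj = (- 1, Qe)"
| "lmult Qk Qk = (- 1, Qe)"
| "lmult Qi Qj = (1, Qk)"
| "lmult Qj Qk = (1, Qi)"
| "lmult Qk Qi = (1, Qj)"
| "lmult Qj Qi = (- 1, Qk)"
| "lmult Qk Qj = (- 1, Qi)"
| "lmult Qi Qk = (- 1, Qj)"

text \<open>A signed word \<open>(s, b)\<close>, with \<open>s\<close> in \<open>{1, -1}\<close>, stands for \<open>s b\<close>.\<close>
type_synonym sword = "int \<times> word"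

definition pos :: "word \<Rightarrow> sword" where
  "pos b = (1, b)"

definition wmult :: "sword \<Rightarrow> sword \<Rightarrow> sword" where
  "wmult x y =
    (fst x * fst y * prod_list (map2 (\<lambda>a b. fst (lmult a b)) (snd x) (snd y)),
     map2 (\<lambda>a b. snd (lmult a b)) (snd x) (snd y))"

definition unsigned :: "sword \<Rightarrow> word" where
  "unsigned x = snd x"

definition prod_word :: "word set \<Rightarrow> word" where
  "prod_word T = (THE w. \<exists>b1 b2 b3. T = {b1, b2, b3} \<and> b1 \<noteq> b2 \<and> b2 \<noteq> b3 \<and> b1 \<noteq> b3 \<and>
     w = unsigned (wmult (wmult (pos b1) (pos b2)) (pos b3)))"

definition product_point :: "real \<Rightarrow> word set \<Rightarrow> real \<times> real" where
  "product_point d T = centroid d (prod_word T)"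

text \<open>Members of \<^term>\<open>triangles d n\<close> have exactly three elements, so this is the mean of the vertices.\<close>
definition tri_center :: "real \<Rightarrow> word set \<Rightarrow> real \<times> real" where
  "tri_center d T = (1 / 3) *\<^sub>R (\<Sum>b\<in>T. centroid d b)"

definition product_centered :: "real \<Rightarrow> nat \<Rightarrow> word set set" where
  "product_centered d n = {T \<in> triangles d n. product_point d T = tri_center d T}"

fun H :: "nat \<Rightarrow> nat" where
  "H 0 = 1"
| "H (Suc 0) = 7"
| "H (Suc (Suc n)) = 5 * H (Suc n) + 5 * H n"

text \<open>The definite description in \<^const>\<open>prod_word\<close> is well defined.\<close>

lemma lmult3_swap:
  "snd (lmult (snd (lmult a b)) c) = snd (lmult (snd (lmult b a)) c)"
  "snd (lmult (snd (lmult a b)) c) = snd (lmult (snd (lmult a c)) b)"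
  by (cases a; cases b; cases c; simp)+

lemma unsigned_prod_nth:
  assumes "b1 \<in> Delta n" "b2 \<in> Delta n" "b3 \<in> Delta n"
  shows "unsigned (wmult (wmult (pos b1) (pos b2)) (pos b3)) =
    map (\<lambda>r. snd (lmult (snd (lmult (b1 ! r) (b2 ! r))) (b3 ! r))) [0..<n]"
  using assms by (intro nth_equalityI) (auto simp: unsigned_def wmult_def pos_def Delta_def)

lemma prod_word_eq:
  assumes "b1 \<in> Delta n" "b2 \<in> Delta n" "b3 \<in> Delta n" "b1 \<noteq> b2" "b2 \<noteq> b3" "b1 \<noteq> b3"
  shows "prod_word {b1, b2, b3} = unsigned (wmult (wmult (pos b1) (pos b2)) (pos b3))"
proof -
  define f where "f a b c = unsigned (wmult (wmult (pos a) (pos b)) (pos c))" for a b c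
  have swap: "f a b c = f b a c" "f a b c = f a c b"
    if "a \<in> Delta n" "b \<in> Delta n" "c \<in> Delta n" for a b c
    unfolding f_def unsigned_prod_nth[OF that(1,2,3)] unsigned_prod_nth[OF that(2,1,3)]
      unsigned_prod_nth[OF that(1,3,2)]
    by (intro map_cong refl lmult3_swap)+
  have "f a b c = f b1 b2 b3"
    if eq: "{b1, b2, b3} = {a, b, c}" and ne: "a \<noteq> b" "b \<noteq> c" "a \<noteq> c" for a b c
  proof -
    consider "a = b1" "b = b2" "c = b3" | "a = b1" "b = b3" "c = b2" | "a = b2" "b = b1" "c = b3"
      | "a = b2" "b = b3" "c = b1" | "a = b3" "b = b1" "c = b2" | "a = b3" "b = b2" "c = b1"
    proof -
      have "a \<in> {b1, b2, b3}" "b \<in> {b1, b2, b3}" "c \<in> {b1, b2, b3}"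
        unfolding eq by simp_all
      then show thesis
        using ne that by auto
    qed
    then show ?thesis
      proof cases
      case 1 then show ?thesis by simp
    next
      case 2 then show ?thesis using swap(2)[OF assms(1,2,3)] by simp
    next
      case 3 then show ?thesis using swap(1)[OF assms(1,2,3)] by simp
    next
      case 4 then show ?thesis
        using swap(1)[OF assms(1,2,3)] swap(2)[OF assms(2,1,3)] by simp
    next
      case 5 then show ?thesis
        using swap(2)[OF assms(1,2,3)] swap(1)[OF assms(1,3,2)] by simp
    next
      case 6 then show ?thesis
        using swap(1)[OF assms(1,2,3)] swap(2)[OF assms(2,1,3)] swap(1)[OF assms(2,3,1)] by simp
    qed
  qed
  then have uniq: "w = f b1 b2 b3"
    if "\<exists>a b c. {b1, b2, b3} = {a, b, c} \<and> a \<noteq> b \<and> b \<noteq> c \<and> a \<noteq> c \<and> w = f a b c" for w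
    using that by metis
  show ?thesis
    unfolding prod_word_def f_def[symmetric]
  proof (rule the_equality)
    show "\<exists>a b c. {b1, b2, b3} = {a, b, c} \<and> a \<noteq> b \<and> b \<noteq> c \<and> a \<noteq> c \<and> f b1 b2 b3 = f a b c"
      by (intro exI[of _ b1] exI[of _ b2] exI[of _ b3]) (simp add: assms(4-6))
  qed (rule uniq)
qed

end

theory Submission
  imports Defs
begin

text \<open>
  A local triangle has two ingredients: the coordinates in \<open>S\<close>, which the three words rotate
  through \<open>i, j, k\<close>, and the coordinates outside \<open>S\<close>, on which the three words agree. At a
  coordinate in \<open>S\<close> the three directions sum to zero and the three letters multiply to \<open>e\<close> up to
  sign; at a coordinate outside \<open>S\<close> the cube of a letter is that letter up to sign. Hence the
  centre of the triangle is the part of \<open>P(b)\<close> coming from outside \<open>S\<close>, and the product word is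
  \<open>b\<close> with the letters in \<open>S\<close> erased. The two points use the same vectors, and differ only in that
  each erased letter is a new \<open>e\<close> and so flips all later signs. Their difference is twice the sum
  of \<open>\<sigma>\<^sub>r d\<^sub>r v(b\<^sub>r)\<close> over the \<open>r\<close> outside \<open>S\<close> that have an odd number of elements of \<open>S\<close> before
  them.

  Such a sum vanishes only if all its terms do (\<open>letter_sum_eq_0\<close>). Up to a constant, its
  horizontal coordinate is a dyadic sum with digits \<open>-1, 0, 1\<close>, in which each nonzero term
  dominates all later ones; this rules out \<open>i\<close> and \<open>k\<close>, and then the vertical coordinate is a
  dyadic sum of the same kind and rules out \<open>j\<close>. So
  being product-centered becomes a combinatorial condition on the pair \<open>(b, S)\<close>
  (\<open>product_centered_iff_balanced\<close>): outside \<open>S\<close>, only the letter \<open>e\<close> may stand after an odd number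
  of elements of \<open>S\<close>. By \<open>letter_sum_eq_0\<close> again, a local triangle never degenerates.

  A local triangle \<open>T\<close> comes from exactly three pairs, one for each of its words taken as \<open>b\<close>, and
  \<open>S = {}\<close> accounts for \<open>4 ^ n\<close> further pairs (\<open>card_balanced_pairs_eq\<close>). The balanced pairs
  themselves are read off letter by letter by an automaton that remembers the parity of the number
  of marked coordinates so far. In the even state there are \<open>4\<close> unmarked letters that stay and
  \<open>3\<close> marked ones that change state; in the odd state there are \<open>1\<close> and \<open>3\<close>. The transfer
  matrix with rows \<open>(4, 3)\<close> and \<open>(3, 1)\<close> has trace \<open>5\<close> and determinant \<open>-5\<close>, which is the
  recurrence \<open>H\<^sub>n = 5 H\<^bsub>n-1\<^esub> + 5 H\<^bsub>n-2\<^esub>\<close>.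
\<close>

section \<open>Dyadic sums of signed letters\<close>

lemma dyadic_sum_bound:
  fixes a :: "nat \<Rightarrow> real"
  assumes "\<And>r. r < n \<Longrightarrow> \<bar>a r\<bar> \<le> 1"
  shows "\<bar>\<Sum>r<n. a r / 2 ^ r\<bar> < 2"
  using assms
proof (induction n arbitrary: a)
  case (Suc n)
  have "\<bar>\<Sum>r<n. a (Suc r) / 2 ^ r\<bar> < 2" "\<bar>a 0\<bar> \<le> 1"
    using Suc.IH[of "\<lambda>r. a (Suc r)"] Suc.prems by auto
  moreover have "(\<Sum>r<Suc n. a r / 2 ^ r) = a 0 + (\<Sum>r<n. a (Suc r) / 2 ^ r) / 2"
    by (simp add: sum.lessThan_Suc_shift sum_divide_distrib mult.commute del: sum.lessThan_Suc)
  ultimately show ?case by linarith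
qed simp

text \<open>
  The tail after the leading digit is smaller than \<open>1\<close> in absolute value, so it cannot cancel
  a leading digit \<open>1\<close> or \<open>-1\<close>; the digits then vanish one after the other.
\<close>
lemma dyadic_sum_eq_0:
  fixes a :: "nat \<Rightarrow> real"
  assumes "\<And>r. r < n \<Longrightarrow> a r \<in> {-1, 0, 1}" and "(\<Sum>r<n. a r / 2 ^ r) = 0" and "r < n"
  shows "a r = 0"
  using assms
proof (induction n arbitrary: a r)
  case (Suc n)
  have rec: "(\<Sum>r<Suc n. a r / 2 ^ r) = a 0 + (\<Sum>r<n. a (Suc r) / 2 ^ r) / 2"
    by (simp add: sum.lessThan_Suc_shift sum_divide_distrib mult.commute del: sum.lessThan_Suc)
  have "\<bar>\<Sum>r<n. a (Suc r) / 2 ^ r\<bar> < 2"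
    using Suc.prems(1) by (intro dyadic_sum_bound) force
  moreover have "a 0 \<in> {-1, 0, 1}"
    using Suc.prems(1) by blast
  ultimately have 0: "a 0 = 0"
    using Suc.prems(2) unfolding rec by auto
  then have "(\<Sum>r<n. a (Suc r) / 2 ^ r) = 0"
    using Suc.prems(2) unfolding rec by simp
  then have "a (Suc r) = 0" if "r < n" for r
    using Suc.IH[of "\<lambda>r. a (Suc r)" r] Suc.prems(1) that by simp
  with 0 Suc.prems(3) show ?case by (cases r) auto
qed simp

lemma vdir_coordinates:
  "vdir Qi = (- (sqrt 3 / 2), - 1 / 2)" "vdir Qj = (0, 1)" "vdir Qk = (sqrt 3 / 2, - 1 / 2)"
  "vdir Qe = (0, 0)"
proof -
  have i: "210 * pi / 180 = pi / 6 + pi" and k: "330 * pi / 180 = - (pi / 6) + 2 * pi"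
    and j: "90 * pi / 180 = pi / 2"
    by simp_all
  show "vdir Qi = (- (sqrt 3 / 2), - 1 / 2)"
    unfolding vdir.simps i by (simp only: cos_periodic_pi sin_periodic_pi cos_30 sin_30) simp
  show "vdir Qj = (0, 1)"
    unfolding vdir.simps j by simp
  show "vdir Qk = (sqrt 3 / 2, - 1 / 2)"
    unfolding vdir.simps k
    by (simp only: cos_periodic sin_periodic cos_minus sin_minus cos_30 sin_30) simp
qed simp

text \<open>
  The horizontal coordinates are multiples of \<open>sqrt 3 / 2\<close> by \<open>-1, 0, 1\<close>, so a vanishing sum can
  contain neither \<open>i\<close> nor \<open>k\<close>. Only \<open>j\<close> remains, whose vertical coordinate is \<open>1\<close>, and the
  dyadic argument applies again.
\<close>
lemma letter_sum_eq_0: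
  fixes s :: "nat \<Rightarrow> real"
  assumes d: "d \<noteq> 0" and s: "\<And>r. r < n \<Longrightarrow> s r \<in> {-1, 0, 1}"
    and zero: "(\<Sum>r<n. (s r * (d / 2 ^ r)) *\<^sub>R vdir (x r)) = 0"
    and r: "r < n" "x r \<noteq> Qe"
  shows "s r = 0"
proof -
  define h where "h r = (case x r of Qi \<Rightarrow> - s r | Qk \<Rightarrow> s r | _ \<Rightarrow> 0)" for r
  have fst_eq: "fst ((s r * (d / 2 ^ r)) *\<^sub>R vdir (x r)) = (d * sqrt 3 / 2) * (h r / 2 ^ r)" for r
    by (cases "x r") (simp_all add: h_def vdir_coordinates mult.commute mult.left_commute del: vdir.simps(1-3))
  have "(\<Sum>r<n. fst ((s r * (d / 2 ^ r)) *\<^sub>R vdir (x r))) = 0"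
    using zero by (simp only: fst_sum[symmetric]) simp
  then have "(\<Sum>r<n. h r / 2 ^ r) = 0"
    unfolding fst_eq sum_distrib_left[symmetric] using d by simp
  moreover have "h r \<in> {-1, 0, 1}" if "r < n" for r
    using s[OF that] by (cases "x r") (auto simp: h_def)
  ultimately have h0: "h r = 0" if "r < n" for r
    using dyadic_sum_eq_0 that by blast
  define v where "v r = (if x r = Qj then s r else 0)" for r
  have snd_eq: "snd ((s r * (d / 2 ^ r)) *\<^sub>R vdir (x r)) = d * (v r / 2 ^ r)" if "r < n" for r
    using h0[OF that] by (cases "x r") (simp_all add: h_def v_def vdir_coordinates del: vdir.simps(1-3))
  have "(\<Sum>r<n. snd ((s r * (d / 2 ^ r)) *\<^sub>R vdir (x r))) = 0"
    using zero by (simp only: snd_sum[symmetric]) simp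
  then have "(\<Sum>r<n. d * (v r / 2 ^ r)) = 0"
    by (subst (asm) sum.cong[OF refl snd_eq]) auto
  then have "(\<Sum>r<n. v r / 2 ^ r) = 0"
    unfolding sum_distrib_left[symmetric] using d by simp
  moreover have "v r \<in> {-1, 0, 1}" if "r < n" for r
    using s[OF that] by (auto simp: v_def)
  ultimately have "v r = 0"
    using dyadic_sum_eq_0 r(1) by blast
  with h0[OF r(1)] r(2) show ?thesis
    by (cases "x r") (auto simp: h_def v_def)
qed

section \<open>The geometry of a local triangle\<close>

lemma gam_eq_iff [simp]: "gam x = Qe \<longleftrightarrow> x = Qe" "gam x = x \<longleftrightarrow> x = Qe"
  "gam (gam x) = x \<longleftrightarrow> x = Qe" "gam (gam x) = gam x \<longleftrightarrow> x = Qe" "gam (gam (gam x)) = x"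
  by (cases x; simp)+

lemma length_gamS [simp]: "length (gamS S b) = length b"
  by (simp add: gamS_def)

lemma nth_gamS: "r < length b \<Longrightarrow> gamS S b ! r = (if r \<in> S then gam (b ! r) else b ! r)"
  by (simp add: gamS_def)

lemma gamS_cube: "gamS S (gamS S (gamS S b)) = b"
  by (rule nth_equalityI) (auto simp: nth_gamS)

lemma supp_gamS [simp]: "supp (gamS S b) = supp b"
  by (auto simp: supp_def nth_gamS split: if_splits)

lemma sgn_at_gamS: "r < length b \<Longrightarrow> sgn_at (gamS S b) r = sgn_at b r"
  by (auto simp: sgn_at_def nth_gamS split: if_splits intro!: arg_cong[where f = "\<lambda>A. (- 1) ^ card A"])

lemma sgn_at_cases: "sgn_at b r \<in> {-1, 1}"
  by (cases "even (card {s. s < r \<and> b ! s = Qe})") (auto simp: sgn_at_def)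

lemma gamS_distinct:
  assumes "S \<noteq> {}" "S \<subseteq> supp b"
  shows "gamS S b \<noteq> b" "gamS S (gamS S b) \<noteq> b" "gamS S (gamS S b) \<noteq> gamS S b"
proof -
  obtain r where r: "r \<in> S" "r < length b" "b ! r \<noteq> Qe"
    using assms by (auto simp: supp_def)
  show "gamS S b \<noteq> b" "gamS S (gamS S b) \<noteq> b" "gamS S (gamS S b) \<noteq> gamS S b"
    using r by (auto dest!: arg_cong[where f = "\<lambda>w. w ! r"] simp: nth_gamS)
qed

text \<open>
  The contributions to the centroid from the coordinates in \<open>S\<close> and from those outside \<open>S\<close>.
  Both are sums over all coordinates with some coefficients set to \<open>0\<close>, the form in which
  \<open>letter_sum_eq_0\<close> applies.
\<close>
definition moving_part :: "real \<Rightarrow> word \<Rightarrow> nat set \<Rightarrow> real \<times> real" where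
  "moving_part d b S =
    (\<Sum>r<length b. (if r \<in> S then sgn_at b r * (d / 2 ^ r) else 0) *\<^sub>R vdir (b ! r))"

definition fixed_part :: "real \<Rightarrow> word \<Rightarrow> nat set \<Rightarrow> real \<times> real" where
  "fixed_part d b S =
    (\<Sum>r<length b. (if r \<in> S then 0 else sgn_at b r * (d / 2 ^ r)) *\<^sub>R vdir (b ! r))"

text \<open>
Rotation by \<open>-120\<close> degrees: the directions of \<open>i, j, k\<close> are at \<open>210, 90, -30\<close> degrees.
\<close>
definition rot :: "real \<times> real \<Rightarrow> real \<times> real" where
  "rot p = (- fst p / 2 + sqrt 3 / 2 * snd p, - (sqrt 3 / 2) * fst p - snd p / 2)"

lemma vdir_gam: "vdir (gam x) = rot (vdir x)"
  by (cases x) (simp_all add: vdir_coordinates rot_def del: vdir.simps(1-3))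

lemma rot_linear: "linear rot"
  by (rule linearI) (auto simp: rot_def field_simps)

lemma centroid_split: "centroid d b = fixed_part d b S + moving_part d b S"
  unfolding centroid_def fixed_part_def moving_part_def sum.distrib[symmetric]
  by (intro sum.cong) auto

lemma fixed_part_gamS: "fixed_part d (gamS S b) S = fixed_part d b S"
  unfolding fixed_part_def by (auto simp: sgn_at_gamS nth_gamS intro!: sum.cong)

text \<open>
  Applying \<^const>\<open>gam\<close> rotates the direction of a letter and leaves every sign alone, because it
  creates and destroys no \<open>e\<close>.
\<close>
lemma moving_part_gamS: "moving_part d (gamS S b) S = rot (moving_part d b S)"
  unfolding moving_part_def linear_sum[OF rot_linear] linear_cmul[OF rot_linear]
  by (auto simp: sgn_at_gamS nth_gamS vdir_gam linear_0[OF rot_linear] intro!: sum.cong)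

lemma moving_part_nonzero:
  assumes "d \<noteq> 0" "S \<noteq> {}" "S \<subseteq> supp b"
  shows "moving_part d b S \<noteq> 0"
proof
  assume 0: "moving_part d b S = 0"
  obtain r where r: "r \<in> S" "r < length b" "b ! r \<noteq> Qe"
    using assms by (auto simp: supp_def)
  define s where "s r = (if r \<in> S then sgn_at b r else 0)" for r
  have "(\<Sum>r<length b. (s r * (d / 2 ^ r)) *\<^sub>R vdir (b ! r)) = moving_part d b S"
    unfolding moving_part_def s_def by (intro sum.cong) auto
  then have "s r = 0"
    using 0 r sgn_at_cases by (intro letter_sum_eq_0[OF assms(1), of "length b" s]) (auto simp: s_def)
  then show False
    using r(1) sgn_at_cases[of b r] by (auto simp: s_def)
qed

lemma rot_sum_zero: "w + rot w + rot (rot w) = 0"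
  by (cases w) (simp add: rot_def field_simps zero_prod_def)

lemma norm_rot: "norm (rot p) = norm p"
proof -
  have "(fst (rot p))\<^sup>2 + (snd (rot p))\<^sup>2 = (fst p)\<^sup>2 + (snd p)\<^sup>2"
    by (simp add: rot_def power2_sum power2_diff field_simps)
  then show ?thesis
    by (simp add: norm_prod_def)
qed

lemma equilateral_rot:
  assumes "w \<noteq> 0"
  shows "equilateral (c + w) (c + rot w) (c + rot (rot w))"
proof -
  have isometry: "dist (rot p) (rot q) = dist p q" for p q
    by (simp add: dist_norm norm_rot flip: linear_diff[OF rot_linear])
  have "rot (rot (rot w)) - w = (rot w + rot (rot w) + rot (rot (rot w))) - (w + rot w + rot (rot w))"
    by simp
  then have "rot (rot (rot w)) = w"
    unfolding rot_sum_zero by simp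
  moreover have "w \<noteq> rot w"
  proof
    assume "w = rot w"
    then have "3 *\<^sub>R w = 0"
      using rot_sum_zero[of w] by (simp add: scaleR_add_left[of 1 2, simplified] scaleR_2 add.assoc)
    with assms show False by simp
  qed
  ultimately show ?thesis
    unfolding equilateral_def using isometry[of w "rot w"] isometry[of "rot w" "rot (rot w)"] by simp
qed

text \<open>
  The three centroids are obtained from the common fixed part by adding a nonzero vector and its
  two rotations.
\<close>
lemma loc_tri_in_triangles:
  assumes "d \<noteq> 0" "b \<in> Delta n" "S \<noteq> {}" "S \<subseteq> supp b"
  shows "loc_tri b S \<in> triangles d n"
proof -
  have "equilateral (centroid d b) (centroid d (gamS S b)) (centroid d (gamS S (gamS S b)))"
    unfolding centroid_split[of d _ S] fixed_part_gamS moving_part_gamS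
    by (rule equilateral_rot[OF moving_part_nonzero[OF assms(1,3,4)]])
  then show ?thesis
    unfolding triangles_def loc_tri_def mem_Collect_eq
    using assms(2) gamS_distinct[OF assms(3,4)]
    by (intro exI[of _ b] exI[of _ "gamS S b"] exI[of _ "gamS S (gamS S b)"]) (auto simp: Delta_def)
qed

lemma tri_center_loc_tri:
  assumes "S \<noteq> {}" "S \<subseteq> supp b"
  shows "tri_center d (loc_tri b S) = fixed_part d b S"
proof -
  have "(\<Sum>c\<in>loc_tri b S. centroid d c)
      = centroid d b + (centroid d (gamS S b) + centroid d (gamS S (gamS S b)))"
    unfolding loc_tri_def using gamS_distinct[OF assms] by (simp add: eq_commute)
  also have "\<dots> = 3 *\<^sub>R fixed_part d b S
      + (moving_part d b S + rot (moving_part d b S) + rot (rot (moving_part d b S)))"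
    unfolding centroid_split[of d _ S] fixed_part_gamS moving_part_gamS
    by (simp add: scaleR_add_left[of 1 2, simplified] scaleR_2 algebra_simps)
  finally show ?thesis
    by (simp add: tri_center_def rot_sum_zero)
qed

section \<open>The product point of a local triangle\<close>

text \<open>
The product word of a local triangle, see \<open>prod_word_loc_tri\<close>.
\<close>
definition erase :: "nat set \<Rightarrow> word \<Rightarrow> word" where
  "erase S b = map (\<lambda>r. if r \<in> S then Qe else b ! r) [0..<length b]"

lemma prod_word_loc_tri:
  assumes "S \<noteq> {}" "S \<subseteq> supp b"
  shows "prod_word (loc_tri b S) = erase S b"
proof -
  have D: "b \<in> Delta (length b)" "gamS S b \<in> Delta (length b)"
    "gamS S (gamS S b) \<in> Delta (length b)"
    by (auto simp: Delta_def)
  have letters: "snd (lmult (snd (lmult x (gam x))) (gam (gam x))) = Qe"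
    "snd (lmult (snd (lmult x x)) x) = x" for x
    by (cases x; simp)+
  show ?thesis
    unfolding loc_tri_def
    by (subst prod_word_eq[OF D], use gamS_distinct[OF assms] in auto)
      (auto simp: unsigned_prod_nth[OF D] erase_def nth_gamS letters)
qed

text \<open>
  Since \<open>S\<close> lies in the support, erasing creates one new \<open>e\<close> for each of its elements.
\<close>
lemma sgn_at_erase:
  assumes "S \<subseteq> supp b" "r < length b"
  shows "sgn_at (erase S b) r = sgn_at b r * (- 1) ^ card (S \<inter> {..<r})"
proof -
  have "{s. s < r \<and> erase S b ! s = Qe} = {s. s < r \<and> b ! s = Qe} \<union> (S \<inter> {..<r})"
    using assms by (auto simp: erase_def)
  moreover have "{s. s < r \<and> b ! s = Qe} \<inter> (S \<inter> {..<r}) = {}"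
    using assms by (auto simp: supp_def)
  ultimately have "card {s. s < r \<and> erase S b ! s = Qe}
      = card {s. s < r \<and> b ! s = Qe} + card (S \<inter> {..<r})"
    by (simp add: card_Un_disjoint)
  then show ?thesis
    by (simp add: sgn_at_def power_add)
qed

definition balanced :: "word \<Rightarrow> nat set \<Rightarrow> bool" where
  "balanced b S \<longleftrightarrow> (\<forall>r<length b. r \<notin> S \<longrightarrow> odd (card (S \<inter> {..<r})) \<longrightarrow> b ! r = Qe)"

text \<open>
  Center minus product point is a signed letter sum of scale \<open>2 * d\<close>: where an even number of erased
  letters come before, the two contributions cancel, and where an odd number come before they have
  opposite signs and add up.
\<close>
lemma product_centered_iff_balanced:
  assumes "d \<noteq> 0" "S \<noteq> {}" "S \<subseteq> supp b"
  shows "product_point d (loc_tri b S) = tri_center d (loc_tri b S) \<longleftrightarrow> balanced b S"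
proof -
  define s where "s r = (if r \<in> S \<or> even (card (S \<inter> {..<r})) then 0 else sgn_at b r)" for r
  have len: "length (erase S b) = length b"
    by (simp add: erase_def)
  have "tri_center d (loc_tri b S) - product_point d (loc_tri b S)
      = fixed_part d b S - centroid d (erase S b)"
    using assms by (simp add: tri_center_loc_tri product_point_def prod_word_loc_tri)
  also have "\<dots> = (\<Sum>r<length b. (s r * ((2 * d) / 2 ^ r)) *\<^sub>R vdir (b ! r))"
    unfolding fixed_part_def centroid_def len sum_subtractf[symmetric]
  proof (intro sum.cong refl)
    fix r assume r: "r \<in> {..<length b}"
    have e: "erase S b ! r = (if r \<in> S then Qe else b ! r)"
      using r by (simp add: erase_def)
    have sg: "sgn_at (erase S b) r = sgn_at b r * (- 1) ^ card (S \<inter> {..<r})"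
      using r assms(3) by (intro sgn_at_erase) auto
    show "(if r \<in> S then 0 else sgn_at b r * (d / 2 ^ r)) *\<^sub>R vdir (b ! r)
        - (sgn_at (erase S b) r * (d / 2 ^ r)) *\<^sub>R vdir (erase S b ! r)
        = (s r * (2 * d / 2 ^ r)) *\<^sub>R vdir (b ! r)"
      unfolding e sg s_def
      by (auto simp: vdir_coordinates zero_prod_def[symmetric] scaleR_add_left[symmetric] simp del: vdir.simps(1-3))
  qed
  finally have diff: "tri_center d (loc_tri b S) - product_point d (loc_tri b S)
      = (\<Sum>r<length b. (s r * ((2 * d) / 2 ^ r)) *\<^sub>R vdir (b ! r))" .
  have "balanced b S" if "product_point d (loc_tri b S) = tri_center d (loc_tri b S)"
    unfolding balanced_def
  proof (intro allI impI, rule ccontr)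
    fix r assume r: "r < length b" "r \<notin> S" "odd (card (S \<inter> {..<r}))" "b ! r \<noteq> Qe"
    have "(\<Sum>r<length b. (s r * ((2 * d) / 2 ^ r)) *\<^sub>R vdir (b ! r)) = 0"
      using that diff by simp
    then have "s r = 0"
      using assms(1) r sgn_at_cases
      by (intro letter_sum_eq_0[of "2 * d" "length b" s]) (auto simp: s_def)
    then show False
      using r sgn_at_cases[of b r] by (auto simp: s_def)
  qed
  moreover have "product_point d (loc_tri b S) = tri_center d (loc_tri b S)" if "balanced b S"
  proof -
    have "(s r * ((2 * d) / 2 ^ r)) *\<^sub>R vdir (b ! r) = 0" if "r < length b" for r
      using \<open>balanced b S\<close> that
      by (auto simp: balanced_def s_def zero_prod_def)
    then have "tri_center d (loc_tri b S) - product_point d (loc_tri b S) = 0"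
      unfolding diff by (intro sum.neutral) blast
    then show ?thesis by simp
  qed
  ultimately show ?thesis by blast
qed

section \<open>Three pairs for each local triangle\<close>

lemma loc_tri_gamS: "loc_tri (gamS S b) S = loc_tri b S"
  unfolding loc_tri_def gamS_cube by blast

lemma differing_positions_loc_tri:
  assumes "S \<subseteq> supp b"
  shows "{r. \<exists>u\<in>loc_tri b S. \<exists>w\<in>loc_tri b S. r < length u \<and> u ! r \<noteq> w ! r} = S"
proof -
  have "r \<in> S" if "u \<in> loc_tri b S" "w \<in> loc_tri b S" "r < length u" "u ! r \<noteq> w ! r" for r u w
    using that by (cases "r \<in> S") (auto simp: loc_tri_def nth_gamS)
  moreover have "\<exists>u\<in>loc_tri b S. \<exists>w\<in>loc_tri b S. r < length u \<and> u ! r \<noteq> w ! r" if "r \<in> S" for r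
    using that assms
    by (intro bexI[of _ b] bexI[of _ "gamS S b"]) (auto simp: loc_tri_def supp_def nth_gamS)
  ultimately show ?thesis by blast
qed

text \<open>
  \<open>S\<close> can be recovered from the triangle as the set of positions where its words disagree, and any
  of its three words can serve as the starting word.
\<close>
lemma loc_tri_fiber:
  assumes "S \<noteq> {}" "S \<subseteq> supp b"
  shows "{(b', S'). S' \<subseteq> supp b' \<and> loc_tri b' S' = loc_tri b S} = loc_tri b S \<times> {S}"
proof (intro equalityI subsetI)
  fix q assume "q \<in> {(b', S'). S' \<subseteq> supp b' \<and> loc_tri b' S' = loc_tri b S}"
  then obtain b' S' where q: "q = (b', S')" "S' \<subseteq> supp b'" "loc_tri b' S' = loc_tri b S"
    by blast
  have "S' = S"
    using differing_positions_loc_tri[OF q(2)] differing_positions_loc_tri[OF assms(2)] q(3) by simp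
  moreover have "b' \<in> loc_tri b S"
    using q(3) by (auto simp: loc_tri_def)
  ultimately show "q \<in> loc_tri b S \<times> {S}"
    using q(1) by simp
next
  fix q assume "q \<in> loc_tri b S \<times> {S}"
  then show "q \<in> {(b', S'). S' \<subseteq> supp b' \<and> loc_tri b' S' = loc_tri b S}"
    using assms(2) loc_tri_gamS[of S b] loc_tri_gamS[of S "gamS S b"]
    by (auto simp: loc_tri_def[of b S])
qed

lemma card_loc_tri:
  assumes "S \<noteq> {}" "S \<subseteq> supp b"
  shows "card (loc_tri b S) = 3"
  using gamS_distinct[OF assms] by (simp add: loc_tri_def eq_commute)

lemma length_in_loc_tri: "u \<in> loc_tri b S \<Longrightarrow> length u = length b"
  by (auto simp: loc_tri_def)

definition balanced_pairs :: "nat \<Rightarrow> (word \<times> nat set) set" where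
  "balanced_pairs n = {(b, S). b \<in> Delta n \<and> S \<subseteq> supp b \<and> balanced b S}"

lemma finite_letter: "finite (UNIV :: letter set)" and card_letter: "card (UNIV :: letter set) = 4"
proof -
  have U: "(UNIV :: letter set) = {Qi, Qj, Qk, Qe}"
    by (auto intro: letter.exhaust)
  show "finite (UNIV :: letter set)" "card (UNIV :: letter set) = 4"
    unfolding U by simp_all
qed

lemma finite_Delta: "finite (Delta n)" and card_Delta: "card (Delta n) = 4 ^ n"
  using finite_lists_length_eq[OF finite_letter, of n] card_lists_length_eq[OF finite_letter, of n]
  by (simp_all add: Delta_def card_letter)

lemma finite_balanced_pairs: "finite (balanced_pairs n)"
proof (rule finite_subset)
  show "balanced_pairs n \<subseteq> Delta n \<times> Pow {..<n}"
    by (auto simp: balanced_pairs_def Delta_def supp_def)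
qed (simp add: finite_Delta)

lemma card_balanced_pairs_eq:
  assumes "d \<noteq> 0"
  shows "card (balanced_pairs n) = 3 * card (product_centered d n \<inter> local_class n) + 4 ^ n"
proof -
  define A where "A = {(b, S) \<in> balanced_pairs n. S \<noteq> {}}"
  define f where "f = (\<lambda>(b, S). loc_tri b S)"
  have finA: "finite A"
    unfolding A_def by (rule finite_subset[OF _ finite_balanced_pairs]) auto
  have image: "f ` A = product_centered d n \<inter> local_class n"
  proof (intro equalityI subsetI)
    fix T assume "T \<in> f ` A"
    then obtain b S where T: "T = loc_tri b S" "b \<in> Delta n" "S \<subseteq> supp b" "balanced b S" "S \<noteq> {}"
      by (auto simp: A_def f_def balanced_pairs_def)
    then show "T \<in> product_centered d n \<inter> local_class n"
      using loc_tri_in_triangles[OF assms T(2,5,3)] product_centered_iff_balanced[OF assms T(5,3)]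
      by (auto simp: product_centered_def local_class_def)
  next
    fix T assume T: "T \<in> product_centered d n \<inter> local_class n"
    then obtain b S where bS: "T = loc_tri b S" "b \<in> Delta n" "S \<noteq> {}" "S \<subseteq> supp b"
      by (auto simp: local_class_def)
    then have "(b, S) \<in> A"
      using T product_centered_iff_balanced[OF assms bS(3,4)]
      by (auto simp: A_def balanced_pairs_def product_centered_def)
    then show "T \<in> f ` A"
      using bS(1) by (force simp: f_def)
  qed
  have fiber: "card {q \<in> A. f q = T} = 3" if T_image: "T \<in> f ` A" for T
  proof -
    obtain b S where T: "T = loc_tri b S" "b \<in> Delta n" "S \<noteq> {}" "S \<subseteq> supp b" "balanced b S"
      using T_image by (auto simp: A_def f_def balanced_pairs_def)
    have "{q \<in> A. f q = T} = loc_tri b S \<times> {S}"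
    proof (intro equalityI subsetI)
      fix q assume "q \<in> {q \<in> A. f q = T}"
      then have "q \<in> {(b', S'). S' \<subseteq> supp b' \<and> loc_tri b' S' = loc_tri b S}"
        by (auto simp: A_def f_def balanced_pairs_def T(1))
      then show "q \<in> loc_tri b S \<times> {S}"
        unfolding loc_tri_fiber[OF T(3,4)] .
    next
      fix q assume q: "q \<in> loc_tri b S \<times> {S}"
      then obtain b' where b': "q = (b', S)" "b' \<in> loc_tri b S" by blast
      have *: "S \<subseteq> supp b'" "loc_tri b' S = loc_tri b S"
        using q unfolding loc_tri_fiber[OF T(3,4), symmetric] b'(1) by auto
      \<comment> \<open>Balancedness depends on the triangle only, being equivalent to product-centeredness.\<close>
      have "balanced b' S"
        using product_centered_iff_balanced[OF assms T(3) T(4)]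
          product_centered_iff_balanced[OF assms T(3) *(1)] *(2) T(5) by simp
      then show "q \<in> {q \<in> A. f q = T}"
        using * T b' length_in_loc_tri[OF b'(2)]
        by (auto simp: A_def f_def balanced_pairs_def Delta_def)
    qed
    then show ?thesis
      by (simp add: card_cartesian_product card_loc_tri[OF T(3,4)])
  qed
  have "card A = (\<Sum>T\<in>f ` A. card {q \<in> A. f q = T})"
    using sum.image_gen[OF finA, of "\<lambda>_. 1::nat" f] by simp
  also have "\<dots> = 3 * card (product_centered d n \<inter> local_class n)"
    using fiber by (simp add: image)
  finally have cardA: "card A = 3 * card (product_centered d n \<inter> local_class n)" .
  \<comment> \<open>The pairs with empty \<open>S\<close> are all balanced, but they give no triangle.\<close>
  have "balanced_pairs n = A \<union> Delta n \<times> {{}}"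
    by (auto simp: A_def balanced_pairs_def balanced_def)
  moreover have "A \<inter> Delta n \<times> {{}} = {}"
    by (auto simp: A_def)
  ultimately show ?thesis
    using finA cardA
    by (simp add: card_Un_disjoint finite_Delta card_cartesian_product card_Delta)
qed

section \<open>Counting balanced pairs by a two-state automaton\<close>

text \<open>
  A pair \<open>(b, S)\<close> is presented as the list of its letters, each with a flag telling whether its
  position is in \<open>S\<close>. The state \<open>p\<close> is true when the number of flagged positions read so far
  is odd.
\<close>
fun accepts :: "bool \<Rightarrow> (letter \<times> bool) list \<Rightarrow> bool" where
  "accepts p [] \<longleftrightarrow> True"
| "accepts p ((x, True) # ms) \<longleftrightarrow> x \<noteq> Qe \<and> accepts (\<not> p) ms"
| "accepts p ((x, False) # ms) \<longleftrightarrow> (p \<longrightarrow> x = Qe) \<and> accepts p ms"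

definition marks :: "(letter \<times> bool) list \<Rightarrow> nat set" where
  "marks ms = {r. r < length ms \<and> snd (ms ! r)}"

lemma card_marks_Cons:
  "card (marks (m # ms) \<inter> {..<Suc r}) = of_bool (snd m) + card (marks ms \<inter> {..<r})"
proof -
  have "marks (m # ms) \<inter> {..<Suc r} = (if snd m then {0} else {}) \<union> Suc ` (marks ms \<inter> {..<r})"
    (is "?L = ?R")
  proof (rule set_eqI)
    show "q \<in> ?L \<longleftrightarrow> q \<in> ?R" for q
      by (cases q) (auto simp: marks_def)
  qed
  then show ?thesis
    by (auto simp: card_insert_if card_image)
qed

text \<open>
  For \<open>p = False\<close> the two conditions on the right are that \<open>S\<close> lies in the support and that the
  pair is balanced; the summand \<open>of_bool p\<close> stands for the flags read before the list and makes the
  induction go through.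
\<close>
lemma accepts_iff:
  "accepts p ms \<longleftrightarrow> (\<forall>r<length ms. (r \<in> marks ms \<longrightarrow> fst (ms ! r) \<noteq> Qe) \<and>
     (r \<notin> marks ms \<longrightarrow> odd (of_bool p + card (marks ms \<inter> {..<r})) \<longrightarrow> fst (ms ! r) = Qe))"
proof (induction p ms rule: accepts.induct)
  case (2 p x ms)
  have "r \<in> marks ((x, True) # ms) \<longleftrightarrow> (case r of 0 \<Rightarrow> True | Suc q \<Rightarrow> q \<in> marks ms)" for r
    by (cases r) (auto simp: marks_def)
  then show ?case
    using 2 by (simp add: All_less_Suc2 card_marks_Cons)
next
  case (3 p x ms)
  have "r \<in> marks ((x, False) # ms) \<longleftrightarrow> (case r of 0 \<Rightarrow> False | Suc q \<Rightarrow> q \<in> marks ms)" for r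
    by (cases r) (auto simp: marks_def)
  then show ?case
    using 3 by (simp add: All_less_Suc2 card_marks_Cons)
qed simp

definition accepted :: "bool \<Rightarrow> nat \<Rightarrow> (letter \<times> bool) list set" where
  "accepted p n = {ms. length ms = n \<and> accepts p ms}"

lemma card_balanced_pairs_accepted: "card (balanced_pairs n) = card (accepted False n)"
proof -
  have marks_zip: "marks (map (\<lambda>r. (b ! r, r \<in> S)) [0..<length b]) = S" if "S \<subseteq> supp b" for b S
    using that by (auto simp: marks_def supp_def)
  have "bij_betw (\<lambda>ms. (map fst ms, marks ms)) (accepted False n) (balanced_pairs n)"
  proof (rule bij_betw_byWitness[where f' = "\<lambda>(b, S). map (\<lambda>r. (b ! r, r \<in> S)) [0..<length b]"])
    show "\<forall>ms\<in>accepted False n. (case (map fst ms, marks ms) of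
        (b, S) \<Rightarrow> map (\<lambda>r. (b ! r, r \<in> S)) [0..<length b]) = ms"
      by (auto intro!: nth_equalityI simp: marks_def)
    show "\<forall>q\<in>balanced_pairs n. (map fst (case q of (b, S) \<Rightarrow> map (\<lambda>r. (b ! r, r \<in> S)) [0..<length b]),
        marks (case q of (b, S) \<Rightarrow> map (\<lambda>r. (b ! r, r \<in> S)) [0..<length b])) = q"
      by (auto simp: balanced_pairs_def marks_zip comp_def map_nth)
    show "(\<lambda>ms. (map fst ms, marks ms)) ` accepted False n \<subseteq> balanced_pairs n"
      by (auto simp: accepted_def accepts_iff balanced_pairs_def balanced_def Delta_def supp_def)
        (auto simp: marks_def)
    show "(\<lambda>(b, S). map (\<lambda>r. (b ! r, r \<in> S)) [0..<length b]) ` balanced_pairs n \<subseteq> accepted False n"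
      by (auto simp: accepted_def accepts_iff balanced_pairs_def balanced_def Delta_def marks_zip)
        (auto simp: supp_def)
  qed
  then show ?thesis
    by (simp add: bij_betw_same_card)
qed

lemma accepted_Suc:
  "accepted p (Suc n) = (\<lambda>(m, ms). m # ms) `
     (({x. p \<longrightarrow> x = Qe} \<times> {False}) \<times> accepted p n \<union> ((- {Qe}) \<times> {True}) \<times> accepted (\<not> p) n)"
  (is "?L = ?R")
proof (rule set_eqI)
  fix ms :: "(letter \<times> bool) list"
  show "ms \<in> ?L \<longleftrightarrow> ms \<in> ?R"
  proof (cases "(p, ms)" rule: accepts.cases)
  qed (auto simp: accepted_def)
qed

lemma finite_accepted: "finite (accepted p n)"
proof (rule finite_subset)
  show "accepted p n \<subseteq> {ms. set ms \<subseteq> UNIV \<and> length ms = n}"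
    by (auto simp: accepted_def)
  show "finite {ms :: (letter \<times> bool) list. set ms \<subseteq> UNIV \<and> length ms = n}"
    by (intro finite_lists_length_eq finite_Prod_UNIV finite_letter) simp
qed

lemma card_accepted_Suc:
  "card (accepted p (Suc n)) = (if p then 1 else 4) * card (accepted p n) + 3 * card (accepted (\<not> p) n)"
proof -
  have fin: "finite A" for A :: "letter set"
    using finite_subset[OF subset_UNIV finite_letter] .
  have "card (- {Qe}) = 3"
    by (simp add: card_letter Compl_eq_Diff_UNIV card_Diff_subset)
  moreover have "card {x. p \<longrightarrow> x = Qe} = (if p then 1 else 4)"
    by (simp add: card_letter)
  moreover have "({x. p \<longrightarrow> x = Qe} \<times> {False}) \<times> accepted p n \<inter>
      ((- {Qe}) \<times> {True}) \<times> accepted (\<not> p) n = {}"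
    by blast
  ultimately show ?thesis
    unfolding accepted_Suc
    by (subst card_image, (auto simp: inj_on_def)[1])
      (simp only: card_Un_disjoint finite_cartesian_product fin finite_accepted finite.intros
        card_cartesian_product card_1_singleton_iff card.empty, simp)
qed

text \<open>
  With \<open>A\<^sub>n\<close> and \<open>B\<^sub>n\<close> the numbers accepted from the even and the odd state,
  \<open>A\<^bsub>n+2\<^esub> = 4 A\<^bsub>n+1\<^esub> + 3 B\<^bsub>n+1\<^esub> = 4 A\<^bsub>n+1\<^esub> + 9 A\<^sub>n + 3 B\<^sub>n\<close>, and \<open>3 B\<^sub>n = A\<^bsub>n+1\<^esub> - 4 A\<^sub>n\<close>
  eliminates the odd state.
\<close>
lemma card_accepted_eq_H: "card (accepted False n) = H n"
proof (induction n rule: H.induct)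
  case 1
  have "accepted p 0 = {[]}" for p by (auto simp: accepted_def)
  then show ?case by simp
next
  case 2
  have "accepted p 0 = {[]}" for p by (auto simp: accepted_def)
  then show ?case by (simp add: card_accepted_Suc)
next
  case (3 n)
  then show ?case
    by (simp add: card_accepted_Suc[of _ "Suc n"] card_accepted_Suc[of True])
      (simp add: card_accepted_Suc)
qed

lemma H_values: "H 1 = 7" "H 2 = 40" "H 3 = 235" "H 4 = 1375" "H 5 = 8050" "H 6 = 47125"
proof -
  have rec: "H n = 5 * H (n - 1) + 5 * H (n - 2)" if "n \<ge> 2" for n
    using that by (cases n rule: H.cases) auto
  show 1: "H 1 = 7" by simp
  show 2: "H 2 = 40" using rec[of 2] 1 by simp
  show 3: "H 3 = 235" using rec[of 3] 1 2 by simp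
  show 4: "H 4 = 1375" using rec[of 4] 2 3 by simp
  show 5: "H 5 = 8050" using rec[of 5] 3 4 by simp
  show 6: "H 6 = 47125" using rec[of 6] 4 5 by simp
qed

theorem theorem6p2:
  fixes d :: real
  assumes "d > 0"
  shows "(\<forall>n\<ge>1. real (card (product_centered d n \<inter> local_class n)) = (real (H n) - 4 ^ n) / 3) \<and>
    map (\<lambda>n. card (product_centered d n \<inter> local_class n)) [1, 2, 3, 4, 5, 6]
      = [1, 8, 57, 373, 2342, 14343]"
proof -
  have main: "H n = 3 * card (product_centered d n \<inter> local_class n) + 4 ^ n" for n
    using card_balanced_pairs_eq[of d n] assms
    by (simp add: card_balanced_pairs_accepted card_accepted_eq_H)
  have "real (card (product_centered d n \<inter> local_class n)) = (real (H n) - 4 ^ n) / 3" for n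
    by (simp add: main[of n])
  moreover have "map (\<lambda>n. card (product_centered d n \<inter> local_class n)) [1, 2, 3, 4, 5, 6]
      = [1, 8, 57, 373, 2342, 14343]"
    using main[of 1] main[of 2] main[of 3] main[of 4] main[of 5] main[of 6] H_values by simp
  ultimately show ?thesis by blast
qed

end
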